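(* There is a universal constant $C$ (one may take $C=7.7$) such that the following holds. Let $(X,d,\nu)$ be a compact measured length space satisfying both conditions $PL(K)$, for a certain $K>0$, and $BBL(0,N)$, for a certain $N>0$. Then the diameter of $X$ satisfies $$\mathrm{Diam}(X)\leq C\sqrt{\frac{N}{K}}.$$
   Context: A length space is a metric space $(X,d)$ in which the distance between two points is the infimum of the lengths of curves joining them. A measured length space $(X,d,\nu)$ is a length space with a Borel probability measure $\nu$. For $x,y\in X$ and $t\in[0,1]$, $Z_t(x,y)$ is the set of $z\in X$ with $d(x,z)=t\,d(x,y)$ and $d(z,y)=(1-t)\,d(x,y)$. $(X,d,\nu)$ satisfies the Prékopa-Leindler inequality $PL(K)$, $K\in\mathbb{R}$, if for every $t\in[0,1]$ and every triple of functions $u,v,w\in L^1(X,\mathbb{R}_+^* )$ (strictly positive, $\nu$-integrable) satisfying $$u(x)^{1-t}v(y)^t\exp\left(-K\frac{t(1-t)}{2}d(x,y)^2\right)\leq w(z)\quad\text{for all }x,y\in X,\ z\in Z_t(x,y),$$ one has $$\left(\int_X u\,d\nu\right)^{1-t}\left(\int_X v\,d\nu\right)^t\leq\int_X w\,d\nu.$$ For $p\in\mathbb{R}\setminus\{0\}$, $t\in[0,1]$ and $a,b\geq 0$, the $p$-mean is $\mathcal{M}_t^p(a,b):=((1-t)a^p+tb^p)^{1/p}$ if $ab\neq0$ and $\mathcal{M}_t^p(a,b):=0$ if $ab=0$. For $p=0$, $\mathcal{M}_t^0(a,b):=a^{1-t}b^t$ if $ab\neq 0$ and $0$ if $ab=0$.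 Also $\mathcal{M}_t^{-\infty}(a,b):=\min(a,b)$. For real $N>0$ and $p\geq-1/N$, $(X,d,\nu)$ satisfies $BBL_p(0,N)$ if for every $t\in[0,1]$ and every triple of ($\nu$-integrable) functions $f,g,h:X\to\mathbb{R}_+$ satisfying $h(z)\geq\mathcal{M}_t^p(f(x),g(y))$ for all $x,y\in X$ and $z\in Z_t(x,y)$, one has $$\int_X h\,d\nu\geq\mathcal{M}_t^{p/(1+Np)}\left(\int_X f\,d\nu,\int_X g\,d\nu\right),$$ where for $p=-1/N$ the exponent $p/(1+Np)$ is understood as $-\infty$. $(X,d,\nu)$ satisfies $BBL(0,N)$ if it satisfies $BBL_p(0,N)$ for every $p\geq-1/N$.
   Formalization: The bound on Diam(X) is proved when the support of ν is all of X, and in general for the diameter of the support; without full support the claim fails, e.g. for a Dirac measure on [0,1], which satisfies every PL(K) and BBL(0,N). *)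

theory Defs
  imports "HOL-Probability.Probability"
begin

definition curve_length :: "(real \<Rightarrow> 'a::metric_space) \<Rightarrow> ennreal" where
  "curve_length \<gamma> =
     (SUP ts \<in> {ts. sorted ts \<and> set ts \<subseteq> {0..1}}.
        \<Sum>i<length ts - 1. ennreal (dist (\<gamma> (ts ! i)) (\<gamma> (ts ! Suc i))))"

text \<open>
  The infimum is taken in the extended nonnegative reals, so it is infinite when no curve joins
  the two points; a length space is therefore path-connected.
\<close>

definition is_length_space :: "'a::metric_space itself \<Rightarrow> bool" where
  "is_length_space _ \<longleftrightarrow>
     (\<forall>x y :: 'a. ennreal (dist x y) =
        (INF \<gamma> \<in> {\<gamma>. path \<gamma> \<and> pathstart \<gamma> = x \<and> pathfinish \<gamma> = y}. curve_length \<gamma>))"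

definition measured_length_space :: "'a::metric_space measure \<Rightarrow> bool" where
  "measured_length_space \<nu> \<longleftrightarrow>
     is_length_space TYPE('a) \<and> prob_space \<nu> \<and> sets \<nu> = sets borel"

text \<open>
  A Borel measure need not charge all of the space. This matters for diameter bounds: a Dirac
  measure satisfies every \<open>PL(K)\<close> and every \<open>BBL(0, N)\<close> below, whatever the space, so that these
  conditions can only control the support.
\<close>

definition measure_support :: "'a::topological_space measure \<Rightarrow> 'a set" where
  "measure_support \<nu> = {x. \<forall>U. open U \<and> x \<in> U \<longrightarrow> emeasure \<nu> U > 0}"

definition intermediate_points :: "real \<Rightarrow> 'a::metric_space \<Rightarrow> 'a \<Rightarrow> 'a set" where
  "intermediate_points t x y =
     {z. dist x z = t * dist x y \<and> dist z y = (1 - t) * dist x y}"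

definition PL :: "real \<Rightarrow> 'a::metric_space measure \<Rightarrow> bool" where
  "PL K \<nu> \<longleftrightarrow>
     (\<forall>t\<in>{0..1}. \<forall>u v w :: 'a \<Rightarrow> real.
        integrable \<nu> u \<and> integrable \<nu> v \<and> integrable \<nu> w \<and>
        (\<forall>x. u x > 0) \<and> (\<forall>x. v x > 0) \<and> (\<forall>x. w x > 0) \<and>
        (\<forall>x y. \<forall>z\<in>intermediate_points t x y.
           u x powr (1 - t) * v y powr t * exp (- K * (t * (1 - t) / 2) * (dist x y)\<^sup>2) \<le> w z)
        \<longrightarrow> (\<integral>x. u x \<partial>\<nu>) powr (1 - t) * (\<integral>x. v x \<partial>\<nu>) powr t \<le> (\<integral>x. w x \<partial>\<nu>))"

definition p_mean :: "real \<Rightarrow> real \<Rightarrow> real \<Rightarrow> real \<Rightarrow> real" where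
  "p_mean p t a b =
     (if a * b = 0 then 0
      else if p = 0 then a powr (1 - t) * b powr t
      else ((1 - t) * a powr p + t * b powr p) powr (1 / p))"

text \<open>
  The exponent \<open>p / (1 + N * p)\<close> with the convention that it is \<open>-\<infinity>\<close> for \<open>p = - 1 / N\<close>, the
  corresponding mean being the minimum.
\<close>

definition BBL_mean :: "real \<Rightarrow> real \<Rightarrow> real \<Rightarrow> real \<Rightarrow> real \<Rightarrow> real" where
  "BBL_mean p N t a b =
     (if p = - 1 / N then min a b else p_mean (p / (1 + N * p)) t a b)"

text \<open>Curvature parameter 0 throughout: these are \<open>BBL\<^sub>p(0, N)\<close> and \<open>BBL(0, N)\<close>.\<close>

definition BBL0_p :: "real \<Rightarrow> real \<Rightarrow> 'a::metric_space measure \<Rightarrow> bool" where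
  "BBL0_p p N \<nu> \<longleftrightarrow>
     (\<forall>t\<in>{0..1}. \<forall>f g h :: 'a \<Rightarrow> real.
        integrable \<nu> f \<and> integrable \<nu> g \<and> integrable \<nu> h \<and>
        (\<forall>x. f x \<ge> 0) \<and> (\<forall>x. g x \<ge> 0) \<and> (\<forall>x. h x \<ge> 0) \<and>
        (\<forall>x y. \<forall>z\<in>intermediate_points t x y. h z \<ge> p_mean p t (f x) (g y))
        \<longrightarrow> (\<integral>x. h x \<partial>\<nu>) \<ge> BBL_mean p N t (\<integral>x. f x \<partial>\<nu>) (\<integral>x. g x \<partial>\<nu>))"

definition BBL0 :: "real \<Rightarrow> 'a::metric_space measure \<Rightarrow> bool" where
  "BBL0 N \<nu> \<longleftrightarrow> (\<forall>p \<ge> - 1 / N. BBL0_p p N \<nu>)"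

end

theory Submission
  imports Defs
begin

text \<open>
  The two hypotheses pull in opposite directions on a pair of balls centred at points \<open>x\<close>, \<open>y\<close> that
  realise the diameter \<open>D\<close> of the support, a compact set of full measure
  (lemma \<open>measure_support_full\<close>).

  Contracting the whole support towards \<open>x\<close>, the inequalities \<open>BBL\<^sub>p(0, N)\<close> for large \<open>p\<close> act as a
  Brunn-Minkowski inequality of dimension \<open>N\<close>: a ball of radius slightly larger than \<open>t D\<close> has
  measure at least \<open>t\<close> to the power \<open>N\<close> (lemma \<open>BBL0_cball_growth\<close>). On the other hand,
  \<open>PL(K)\<close> at the midpoint makes two sets at distance \<open>L\<close> from each other have product of measures
  at most \<open>exp (- K L\<^sup>2 / 4)\<close> (lemma \<open>PL_separation\<close>). With \<open>t = 1/8\<close> and balls of radius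
  \<open>5/32 D\<close>, whose distance is at least \<open>11/16 D\<close>, the two bounds together give
  \<open>K/8 (11/16 D)\<^sup>2 \<le> N ln 8 \<le> 3 N\<close>, hence \<open>D\<^sup>2 \<le> (6144/121) N / K\<close>, and
  \<open>6144/121 < 50.8 < 7.7\<^sup>2\<close>. Optimising the radii would lower the constant to about \<open>5.35\<close>.
\<close>

lemma closed_measure_support: "closed (measure_support \<nu>)"
  unfolding closed_def
proof (subst open_subopen, safe)
  fix x assume "x \<notin> measure_support \<nu>"
  then obtain U where "open U" "x \<in> U" "\<not> emeasure \<nu> U > 0"
    by (auto simp: measure_support_def)
  then show "\<exists>T. open T \<and> x \<in> T \<and> T \<subseteq> - measure_support \<nu>"
    by (intro exI[of _ U]) (auto simp: measure_support_def)
qed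

lemma compact_disjoint_support_null:
  assumes "compact C" "C \<inter> measure_support \<nu> = {}" "sets \<nu> = sets borel"
  shows "emeasure \<nu> C = 0"
proof -
  define \<U> where "\<U> = {U. open U \<and> emeasure \<nu> U = 0}"
  have "C \<subseteq> \<Union>\<U>"
  proof
    fix x assume "x \<in> C"
    then have "x \<notin> measure_support \<nu>" using assms(2) by auto
    then obtain U where "open U" "x \<in> U" "\<not> emeasure \<nu> U > 0"
      unfolding measure_support_def by auto
    then show "x \<in> \<Union>\<U>" unfolding \<U>_def by (intro UnionI[of U]) auto
  qed
  moreover have "\<forall>U\<in>\<U>. open U" by (simp add: \<U>_def)
  ultimately obtain \<F> where F: "\<F> \<subseteq> \<U>" "finite \<F>" "C \<subseteq> \<Union>\<F>"
    using compactE[OF assms(1), of \<U>] by auto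
  have "(\<Union>U\<in>\<F>. U) \<in> null_sets \<nu>"
  proof (rule null_sets_UN')
    show "countable \<F>" using F(2) by (rule countable_finite)
    show "U \<in> null_sets \<nu>" if "U \<in> \<F>" for U
      using that F(1) assms(3) by (auto simp: \<U>_def null_sets_def)
  qed
  then have "\<Union>\<F> \<in> sets \<nu>" "emeasure \<nu> (\<Union>\<F>) = 0" by (simp_all add: null_setsD1 null_setsD2)
  then show ?thesis
    using emeasure_mono[OF F(3), of \<nu>] by simp
qed

text \<open>
  The complement of the support is the union over \<open>n\<close> of the sets of points at distance at least
  \<open>1/(n + 1)\<close> from the support. These are compact, hence covered by finitely many null open sets.
\<close>

lemma measure_support_full:
  fixes \<nu> :: "'a::metric_space measure"
  assumes "compact (UNIV :: 'a set)" "prob_space \<nu>" "sets \<nu> = sets borel"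
  shows "measure \<nu> (measure_support \<nu>) = 1"
proof -
  interpret prob_space \<nu> by fact
  have sp: "space \<nu> = UNIV" using sets_eq_imp_space_eq[OF assms(3)] by simp
  let ?S = "measure_support \<nu>"
  have ne: "?S \<noteq> {}"
    using compact_disjoint_support_null[OF assms(1) _ assms(3)] emeasure_space_1 sp by auto
  have C: "{x. infdist x ?S \<ge> 1 / Suc n} \<in> null_sets \<nu>" for n
  proof -
    have cl: "closed {x. infdist x ?S \<ge> 1 / Suc n}"
      by (intro closed_Collect_le continuous_intros)
    then have "compact {x. infdist x ?S \<ge> 1 / Suc n}"
      using compact_Int_closed[OF assms(1) cl] by simp
    moreover have "{x. infdist x ?S \<ge> 1 / Suc n} \<inter> ?S = {}"
      by (auto simp: field_simps)
    ultimately show ?thesis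
      using compact_disjoint_support_null assms(3) cl by (auto simp: null_sets_def)
  qed
  have "- ?S \<subseteq> (\<Union>n. {x. infdist x ?S \<ge> 1 / Suc n})"
  proof
    fix x assume "x \<in> - ?S"
    then have "infdist x ?S > 0"
      using infdist_pos_not_in_closed[OF closed_measure_support ne] by auto
    then obtain n where "inverse (real (Suc n)) < infdist x ?S"
      using reals_Archimedean by blast
    then show "x \<in> (\<Union>n. {x. infdist x ?S \<ge> 1 / Suc n})"
      by (auto simp: inverse_eq_divide intro!: exI[of _ n])
  qed
  moreover have "(\<Union>n. {x. infdist x ?S \<ge> 1 / Suc n}) \<in> null_sets \<nu>"
    using C by (rule null_sets_UN)
  moreover have "- ?S \<in> sets \<nu>"
    using closed_measure_support[of \<nu>] assms(3) by auto
  ultimately have "- ?S \<in> null_sets \<nu>"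
    by (metis null_sets_subset)
  then have "AE x in \<nu>. x \<in> ?S"
    by (rule AE_I') auto
  then show ?thesis
    using prob_eq_1[of ?S] closed_measure_support[of \<nu>] assms(3) by auto
qed

text \<open>
  For indicator functions the pointwise hypothesis of \<open>BBL\<^sub>p(0, N)\<close> is the same for all \<open>p\<close>, so
  \<open>p\<close> is free to tend to infinity, where the exponent \<open>p / (1 + N p)\<close> becomes \<open>1 / N\<close>. The support
  is contracted towards a small ball around \<open>x\<close> instead of the point \<open>x\<close>, because the mean vanishes
  unless both integrals are positive; \<open>x\<close> being in the support makes this ball charged, and its
  size is the reason for the slack \<open>r > t D\<close>.
\<close>

lemma BBL0_cball_growth:
  fixes \<nu> :: "'a::metric_space measure"
  assumes "prob_space \<nu>" "sets \<nu> = sets borel" and full: "measure \<nu> (measure_support \<nu>) = 1"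
    and "N > 0" "BBL0 N \<nu>" and x: "x \<in> measure_support \<nu>"
    and D: "\<And>y. y \<in> measure_support \<nu> \<Longrightarrow> dist x y \<le> D"
    and t: "0 < t" "t \<le> 1" and r: "t * D < r"
  shows "t powr N \<le> measure \<nu> (cball x r)"
proof -
  interpret prob_space \<nu> by fact
  have sp: "space \<nu> = UNIV" using sets_eq_imp_space_eq[OF assms(2)] by simp
  have [measurable]: "open U \<Longrightarrow> U \<in> sets \<nu>" "closed U \<Longrightarrow> U \<in> sets \<nu>" for U
    using assms(2) by auto
  \<comment> \<open>Moving the centre by \<open>\<epsilon>\<close> displaces the contracted points by at most \<open>2 \<epsilon>\<close>.\<close>
  define \<epsilon> where "\<epsilon> = (r - t * D) / 2"
  have \<epsilon>: "\<epsilon> > 0" using r by (simp add: \<epsilon>_def)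
  define A where "A = ball x \<epsilon>"
  have A: "measure \<nu> A > 0"
    using x \<epsilon> unfolding measure_support_def A_def by (auto simp: emeasure_eq_measure)
  have sets: "A \<in> sets \<nu>" "measure_support \<nu> \<in> sets \<nu>" "cball x r \<in> sets \<nu>"
    using closed_measure_support[of \<nu>] by (auto simp: A_def)
  have int: "integrable \<nu> (indicat_real B)" if "B \<in> sets \<nu>" for B
    using that by (simp add: integrable_indicator_iff emeasure_eq_measure)
  have contract: "z \<in> cball x r"
    if "x' \<in> A" "y \<in> measure_support \<nu>" "z \<in> intermediate_points t x' y" for x' y z
  proof -
    have "dist x z \<le> dist x x' + dist x' z" by (rule dist_triangle)
    also have "dist x' z = t * dist x' y" using that(3) by (simp add: intermediate_points_def)
    also have "t * dist x' y \<le> t * (dist x x' + dist x y)"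
      using t by (intro mult_left_mono dist_triangle3) auto
    also have "dist x x' + t * (dist x x' + dist x y) \<le> \<epsilon> + t * (\<epsilon> + D)"
      using that(1,2) t D[of y] by (intro add_mono mult_left_mono) (auto simp: A_def)
    also have "\<dots> \<le> r"
      using mult_right_mono[of t 1 \<epsilon>] t \<epsilon> by (simp add: \<epsilon>_def field_simps)
    finally show ?thesis by simp
  qed
  have bound: "t powr (N + 1 / p) \<le> measure \<nu> (cball x r)" if p: "p > 0" for p
  proof -
    have "- 1 / N < p" using p \<open>N > 0\<close> by (smt (verit) divide_neg_pos)
    then have BBL: "BBL0_p p N \<nu>" "p \<noteq> - 1 / N" using \<open>BBL0 N \<nu>\<close> by (auto simp: BBL0_def)
    define q where "q = p / (1 + N * p)"
    have q: "q > 0" "1 / q = N + 1 / p"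
      using p \<open>N > 0\<close> by (auto simp: q_def field_simps add_pos_pos)
    have "p_mean p t (indicator A x') (indicator (measure_support \<nu>) y)
        \<le> indicat_real (cball x r) z" if "z \<in> intermediate_points t x' y" for x' y z
      using contract[OF _ _ that] p by (cases "x' \<in> A \<and> y \<in> measure_support \<nu>")
        (auto simp: p_mean_def)
    then have "BBL_mean p N t (\<integral>y. indicator A y \<partial>\<nu>) (\<integral>y. indicator (measure_support \<nu>) y \<partial>\<nu>)
        \<le> (\<integral>y. indicator (cball x r) y \<partial>\<nu>)"
      using BBL(1)[unfolded BBL0_p_def, THEN bspec[of _ _ t], THEN spec[of _ "indicator A"],
          THEN spec[of _ "indicator (measure_support \<nu>)"], THEN spec[of _ "indicator (cball x r)"],
          THEN mp] t int[OF sets(1)] int[OF sets(2)] int[OF sets(3)]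
      by (metis (no_types, lifting) atLeastAtMost_iff indicator_pos_le less_imp_le)
    then have "BBL_mean p N t (measure \<nu> A) 1 \<le> measure \<nu> (cball x r)"
      using sets sp full by simp
    moreover have "t powr (1 / q) \<le> BBL_mean p N t (measure \<nu> A) 1"
      using A BBL(2) q(1) t unfolding BBL_mean_def q_def[symmetric] p_mean_def
      by (auto intro!: powr_mono2)
    ultimately show ?thesis by (simp add: q(2))
  qed
  have "((\<lambda>p. t powr (N + 1 / p)) \<longlongrightarrow> t powr (N + 0)) at_top"
    using t by (intro tendsto_intros tendsto_divide_0[OF tendsto_const] filterlim_ident
        filterlim_at_top_imp_at_infinity) auto
  then show ?thesis
    using tendsto_upperbound[OF _ eventually_mono[OF eventually_gt_at_top[of 0] bound]]
    by simp
qed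

text \<open>
  This is \<open>PL(K)\<close> at \<open>t = 1/2\<close> for the two indicator functions and a constant function. Since
  strictly positive functions are required, the indicators are raised by \<open>\<delta>\<close>; the pairs outside
  \<open>A \<times> B\<close> then contribute at most \<open>sqrt (\<delta> (1 + \<delta>))\<close>, which disappears as \<open>\<delta>\<close> tends to 0.
\<close>

lemma PL_separation:
  fixes \<nu> :: "'a::metric_space measure"
  assumes "prob_space \<nu>" "sets \<nu> = sets borel" and "K \<ge> 0" "PL K \<nu>"
    and AB: "A \<in> sets \<nu>" "B \<in> sets \<nu>"
    and L: "L \<ge> 0" "\<And>x y. x \<in> A \<Longrightarrow> y \<in> B \<Longrightarrow> L \<le> dist x y"
  shows "sqrt (measure \<nu> A * measure \<nu> B) \<le> exp (- K * L\<^sup>2 / 8)"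
proof -
  interpret prob_space \<nu> by fact
  have sp: "space \<nu> = UNIV" using sets_eq_imp_space_eq[OF assms(2)] by simp
  have int: "integrable \<nu> (indicat_real E)" if "E \<in> sets \<nu>" for E
    using that by (simp add: integrable_indicator_iff emeasure_eq_measure)
  define W where "W \<delta> = (1 + \<delta>) * exp (- K * L\<^sup>2 / 8) + sqrt (\<delta> * (1 + \<delta>))" for \<delta> :: real
  have bound: "sqrt (measure \<nu> A * measure \<nu> B) \<le> W \<delta>" if \<delta>: "\<delta> > 0" for \<delta>
  proof -
    define u v where "u x = indicat_real A x + \<delta>" and "v x = indicat_real B x + \<delta>" for x
    have pos: "u x > 0" "v x > 0" for x
      using \<delta> by (auto simp: u_def v_def indicator_def)
    have W_pos: "W \<delta> > 0"
      unfolding W_def using \<delta> by (intro add_pos_nonneg mult_pos_pos) auto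
    have le: "sqrt (u x * v y) * exp (- K * (dist x y)\<^sup>2 / 8) \<le> W \<delta>" for x y
    proof (cases "x \<in> A \<and> y \<in> B")
      case True
      have "L\<^sup>2 \<le> (dist x y)\<^sup>2" using L True by (intro power_mono) auto
      then have "exp (- K * (dist x y)\<^sup>2 / 8) \<le> exp (- K * L\<^sup>2 / 8)"
        using \<open>K \<ge> 0\<close> by (simp add: mult_left_mono)
      moreover have "sqrt (u x * v y) = 1 + \<delta>"
        using True \<delta> by (simp add: u_def v_def)
      ultimately have "sqrt (u x * v y) * exp (- K * (dist x y)\<^sup>2 / 8)
          \<le> (1 + \<delta>) * exp (- K * L\<^sup>2 / 8)"
        using \<delta> by (simp add: mult_left_mono)
      also have "\<dots> \<le> W \<delta>" using \<delta> by (simp add: W_def)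
      finally show ?thesis .
    next
      case False
      have "exp (- K * (dist x y)\<^sup>2 / 8) \<le> 1" using \<open>K \<ge> 0\<close> by simp
      then have "sqrt (u x * v y) * exp (- K * (dist x y)\<^sup>2 / 8) \<le> sqrt (u x * v y)"
        using pos[of x] pos[of y] by (simp add: mult_left_le)
      also have "u x * v y \<le> \<delta> * (1 + \<delta>)"
        using False \<delta> by (auto simp: u_def v_def indicator_def algebra_simps)
      finally have "sqrt (u x * v y) * exp (- K * (dist x y)\<^sup>2 / 8) \<le> sqrt (\<delta> * (1 + \<delta>))"
        by simp
      also have "\<dots> \<le> W \<delta>" using \<delta> by (simp add: W_def)
      finally show ?thesis .
    qed
    have ints: "integrable \<nu> u" "integrable \<nu> v"
      using AB int unfolding u_def v_def by auto
    \<comment> \<open>The exponents stay in the shape \<open>1 - t\<close>, \<open>t\<close> so that the definition of \<open>PL\<close> matches.\<close>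
    have half: "a powr (1 - 1 / 2) * b powr (1 / 2) = sqrt (a * b)" if "a \<ge> 0" "b \<ge> 0"
      for a b :: real
      using that by (simp add: powr_half_sqrt real_sqrt_mult)
    have "(\<integral>x. u x \<partial>\<nu>) powr (1 - 1 / 2) * (\<integral>x. v x \<partial>\<nu>) powr (1 / 2) \<le> (\<integral>x. W \<delta> \<partial>\<nu>)"
    proof -
      have "\<forall>x y. \<forall>z\<in>intermediate_points (1 / 2) x y.
          u x powr (1 - 1 / 2) * v y powr (1 / 2)
            * exp (- K * (1 / 2 * (1 - 1 / 2) / 2) * (dist x y)\<^sup>2) \<le> W \<delta>"
      proof (intro allI ballI)
        fix x y z :: 'a
        have "exp (- K * (1 / 2 * (1 - 1 / 2) / 2) * (dist x y)\<^sup>2)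
            = exp (- K * (dist x y)\<^sup>2 / 8)" by simp
        then show "u x powr (1 - 1 / 2) * v y powr (1 / 2)
            * exp (- K * (1 / 2 * (1 - 1 / 2) / 2) * (dist x y)\<^sup>2) \<le> W \<delta>"
          using le[of x y] half[of "u x" "v y"] pos[of x] pos[of y] by simp
      qed
      moreover have "integrable \<nu> (\<lambda>_. W \<delta>)" "(1 / 2 :: real) \<in> {0..1}" by auto
      ultimately show ?thesis
        using \<open>PL K \<nu>\<close> ints pos W_pos unfolding PL_def by blast
    qed
    moreover have "(\<integral>x. u x \<partial>\<nu>) = measure \<nu> A + \<delta>" "(\<integral>x. v x \<partial>\<nu>) = measure \<nu> B + \<delta>"
      using AB int by (simp_all add: u_def v_def sp prob_space[unfolded sp])
    ultimately have "sqrt ((measure \<nu> A + \<delta>) * (measure \<nu> B + \<delta>)) \<le> W \<delta>"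
      using half[of "measure \<nu> A + \<delta>" "measure \<nu> B + \<delta>"] \<delta> prob_space
      by (simp add: sp add_nonneg_nonneg)
    moreover have "sqrt (measure \<nu> A * measure \<nu> B) \<le> sqrt ((measure \<nu> A + \<delta>) * (measure \<nu> B + \<delta>))"
      using \<delta> by (intro real_sqrt_le_mono mult_mono) (auto intro: add_nonneg_nonneg)
    ultimately show ?thesis by linarith
  qed
  have "(W \<longlongrightarrow> (1 + 0) * exp (- K * L\<^sup>2 / 8) + sqrt (0 * (1 + 0))) (at_right 0)"
    unfolding W_def by (intro tendsto_intros)
  moreover have "\<forall>\<^sub>F \<delta> in at_right 0. sqrt (measure \<nu> A * measure \<nu> B) \<le> W \<delta>"
    using eventually_at_right_less by (rule eventually_mono) (rule bound)
  ultimately show ?thesis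
    using tendsto_lowerbound[of W _ "at_right 0"] by simp
qed

theorem theorem3p7:
  fixes \<nu> :: "'a::metric_space measure" and K N :: real
  assumes "compact (UNIV :: 'a set)"
    and "measured_length_space \<nu>"
    and "K > 0" and "PL K \<nu>"
    and "N > 0" and "BBL0 N \<nu>"
  shows "(measure_support \<nu> = UNIV \<longrightarrow> diameter (UNIV :: 'a set) \<le> 7.7 * sqrt (N / K)) \<and>
         diameter (measure_support \<nu>) \<le> 7.7 * sqrt (N / K)"
proof -
  have P: "prob_space \<nu>" and S: "sets \<nu> = sets borel"
    using assms(2) by (auto simp: measured_length_space_def)
  note full = measure_support_full[OF assms(1) P S]
  have cpt: "compact (measure_support \<nu>)"
    using compact_Int_closed[OF assms(1) closed_measure_support] by simp
  have ne: "measure_support \<nu> \<noteq> {}" using full by auto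
  define D where "D = diameter (measure_support \<nu>)"
  have le_D: "dist x y \<le> D" if "x \<in> measure_support \<nu>" "y \<in> measure_support \<nu>" for x y
    using that diameter_bounded_bound[OF compact_imp_bounded[OF cpt]] by (simp add: D_def)
  have main: "D \<le> 7.7 * sqrt (N / K)"
  proof (cases "D > 0")
    case False
    moreover have "0 \<le> 7.7 * sqrt (N / K)" using assms by simp
    ultimately show ?thesis by linarith
  next
    case True
    obtain a b where ab: "a \<in> measure_support \<nu>" "b \<in> measure_support \<nu>" "dist a b = D"
      using diameter_compact_attained[OF cpt ne] by (auto simp: D_def)
    define R where "R = 5 / 32 * D"
    have ball: "(1 / 8) powr N \<le> measure \<nu> (cball x R)" if "x \<in> measure_support \<nu>" for x
      using that True le_D
      by (intro BBL0_cball_growth[OF P S full assms(5,6), where D = D]) (auto simp: R_def)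
    have sep: "11 / 16 * D \<le> dist x y" if "x \<in> cball a R" "y \<in> cball b R" for x y
    proof -
      have "dist a b \<le> dist a x + dist x y + dist y b"
        using dist_triangle[of a b x] dist_triangle[of x b y] by linarith
      then show ?thesis using that ab(3) by (simp add: R_def dist_commute)
    qed
    have "(1 / 8) powr N = sqrt ((1 / 8) powr N * (1 / 8) powr N)" by simp
    also have "\<dots> \<le> sqrt (measure \<nu> (cball a R) * measure \<nu> (cball b R))"
      using ball ab by (intro real_sqrt_le_mono mult_mono) auto
    also have "\<dots> \<le> exp (- K * (11 / 16 * D)\<^sup>2 / 8)"
      using assms(3,4) S True sep by (intro PL_separation[OF P S]) auto
    finally have "N * ln (1 / 8) \<le> - K * (11 / 16 * D)\<^sup>2 / 8"
      by (simp add: powr_def)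
    moreover have "ln (1 / 8 :: real) \<ge> - 3"
    proof -
      have "ln (8 :: real) = 3 * ln 2"
        using ln_realpow[of 2 3] by simp
      then show ?thesis using ln_le_minus_one[of 2] by (simp add: ln_div)
    qed
    then have "N * ln (1 / 8) \<ge> N * (- 3)" using assms(5) by (intro mult_left_mono) auto
    ultimately have "K * D\<^sup>2 * 121 \<le> 6144 * N"
      by (simp add: power_mult_distrib power_divide)
    moreover have "N > 0" by fact
    ultimately have "K * D\<^sup>2 \<le> 7.7\<^sup>2 * N" by (simp add: power2_eq_square)
    then have "D\<^sup>2 \<le> 7.7\<^sup>2 * (N / K)" using assms(3) by (simp add: field_simps)
    then have "sqrt (D\<^sup>2) \<le> sqrt (7.7\<^sup>2 * (N / K))" by (rule real_sqrt_le_mono)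
    then show ?thesis using True unfolding real_sqrt_mult by simp
  qed
  then show ?thesis by (auto simp: D_def)
qed

end
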